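(* Let $n\in\mathbb{N}$. Then $$t(1,4,4,4;n)=\frac12\big(\sigma(8n+13)-3S_4(8n+13)\big).$$
   Context: $\mathbb{N}$ denotes the set of positive integers. For $a,b,c,d\in\mathbb{N}$ and an integer $m\ge0$, $t(a,b,c,d;m)$ is the number of $(x,y,z,w)\in\mathbb{Z}^4$ with $m = a\frac{x(x-1)}{2}+b\frac{y(y-1)}{2}+c\frac{z(z-1)}{2}+d\frac{w(w-1)}{2}$. $\sigma(m)$ is the sum of the positive divisors of $m$. For $m,k\in\mathbb{N}$ with $m$ even and $k$ odd, $S_m(k)=\sum r$, the sum over all $(r,s)\in\mathbb{Z}\times\mathbb{Z}$ with $k=r^2+ms^2$ and $r\equiv1\pmod 4$. *)

theory Defs
  imports Complex_Main "HOL-Number_Theory.Cong"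
begin

(* The division by 2 is exact, since x * (x - 1) is even. For a, b, c, d > 0
   the set is finite, so that its cardinality is the intended count. *)
definition t :: "nat \<Rightarrow> nat \<Rightarrow> nat \<Rightarrow> nat \<Rightarrow> nat \<Rightarrow> nat" where
  "t a b c d m = card {(x :: int, y :: int, z :: int, w :: int).
     int m = int a * (x * (x - 1) div 2) + int b * (y * (y - 1) div 2)
           + int c * (z * (z - 1) div 2) + int d * (w * (w - 1) div 2)}"

(* Intended for m > 0; the value at 0 is irrelevant. *)
definition sigma :: "nat \<Rightarrow> nat" where
  "sigma m = \<Sum>{d. d dvd m}"

(* Intended for even m > 0 and odd k; the index set is finite whenever m > 0. *)
definition S :: "nat \<Rightarrow> nat \<Rightarrow> int" where
  "S m k = (\<Sum>(r, s) \<in> {(r :: int, s :: int).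
     int k = r\<^sup>2 + int m * s\<^sup>2 \<and> [r = 1] (mod 4)}. r)"

end

theory Submission
  imports Defs "HOL-Computational_Algebra.Formal_Power_Series"
begin

unbundle fps_syntax

text \<open>
  Put \<open>N = 8 n + 13\<close>, let \<open>A\<close> be the number of solutions of \<open>N = x\<^sup>2 + 4 (y\<^sup>2 + z\<^sup>2 + w\<^sup>2)\<close>
  in odd integers, which is \<open>t(1,4,4,4;n)\<close>, and let \<open>B\<close> be the number of solutions with \<open>x, y\<close>
  odd and \<open>z, w\<close> even. As \<open>N \<equiv> 5\<close> modulo 8, the solutions of \<open>N = x\<^sup>2 + y\<^sup>2 + z\<^sup>2 + w\<^sup>2\<close> number
  \<open>4 (A + 3 B)\<close>, so that Jacobi's four-square theorem gives \<open>A + 3 B = 2 \<sigma>(N)\<close>. On the other hand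
  \<open>B - A = 2 S\<^sub>4(N)\<close> follows from
  \<open>\<Sum> \<chi>(r) r q^(r\<^sup>2) = \<Sum> q^(x\<^sup>2) (\<Sum> (-1)^u q^(8 u\<^sup>2))\<^sup>2\<close>, where \<open>r\<close> and \<open>x\<close> run over the odd
  integers, \<open>u\<close> over all integers, and \<open>\<chi>\<close> is the nontrivial character modulo 4: multiply by
  \<open>\<Sum> q^(4 y\<^sup>2)\<close>, \<open>y\<close> odd, and put \<open>z = u + v\<close>, \<open>w = u - v\<close>.

  Both this identity and \<open>(\<Sum> q^(x\<^sup>2))^4 = 16 \<Sum> \<sigma>(m) q^(4 m)\<close> (\<open>x\<close> and \<open>m\<close> odd, \<open>m > 0\<close>), which
  yields the four-square theorem for odd numbers, are proved by comparing logarithmic derivatives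
  of the two sides. After clearing denominators, each comparison says that a cubic polynomial, up
  to a sign character, sums to zero over the solutions of a quadratic equation, and this is shown
  by means of involutions.
\<close>

section \<open>Weighted generating functions\<close>

definition finite_fibres :: "'a set \<Rightarrow> ('a \<Rightarrow> nat) \<Rightarrow> bool" where
  "finite_fibres A f \<longleftrightarrow> (\<forall>k. finite {x \<in> A. f x = k})"

text \<open>This stands for the formal series of \<open>w x\<close> times q^(\<open>f x\<close>)
  over \<open>A\<close>. A sum over an infinite fibre takes the default value 0, so the product rule
  assumes \<open>finite_fibres\<close>.\<close>

definition weighted_gf :: "'a set \<Rightarrow> ('a \<Rightarrow> nat) \<Rightarrow> ('a \<Rightarrow> real) \<Rightarrow> real fps" where
  "weighted_gf A f w = Abs_fps (\<lambda>k. \<Sum>x | x \<in> A \<and> f x = k. w x)"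

lemma weighted_gf_nth: "weighted_gf A f w $ k = (\<Sum>x | x \<in> A \<and> f x = k. w x)"
  by (simp add: weighted_gf_def)

lemma weighted_gf_cong:
  assumes "\<And>x. x \<in> A \<Longrightarrow> f x = g x" "\<And>x. x \<in> A \<Longrightarrow> w x = v x"
  shows "weighted_gf A f w = weighted_gf A g v"
proof (rule fps_ext)
  fix k
  have "{x \<in> A. f x = k} = {x \<in> A. g x = k}" using assms(1) by auto
  then show "weighted_gf A f w $ k = weighted_gf A g v $ k"
    unfolding weighted_gf_nth by (rule sum.cong) (use assms(2) in auto)
qed

lemma product_fibre:
  "{z \<in> A \<times> B. (case z of (x, y) \<Rightarrow> f x + g y) = k} =
     (\<Union>i\<in>{0..k}. {x \<in> A. f x = i} \<times> {y \<in> B. g y = k - i})"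
  for f g :: "_ \<Rightarrow> nat"
  by auto

lemma finite_fibres_Times:
  assumes "finite_fibres A f" "finite_fibres B g"
  shows "finite_fibres (A \<times> B) (\<lambda>(x, y). f x + g y)"
  using assms unfolding finite_fibres_def product_fibre by blast

text \<open>Cutting the fibre over \<open>k\<close> into rectangles by the value of \<open>f\<close>
  yields the Cauchy product.\<close>

lemma weighted_gf_mult:
  assumes "finite_fibres A f" "finite_fibres B g"
  shows "weighted_gf A f w * weighted_gf B g v = weighted_gf (A \<times> B) (\<lambda>(x, y). f x + g y) (\<lambda>(x, y). w x * v y)"
proof (rule fps_ext)
  fix k
  have fin: "finite {x \<in> A. f x = i}" "finite {y \<in> B. g y = i}" for i
    using assms by (auto simp: finite_fibres_def)
  have "weighted_gf (A \<times> B) (\<lambda>(x, y). f x + g y) (\<lambda>(x, y). w x * v y) $ k =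
      (\<Sum>z\<in>(\<Union>i\<in>{0..k}. {x \<in> A. f x = i} \<times> {y \<in> B. g y = k - i}). case z of (x, y) \<Rightarrow> w x * v y)"
    unfolding weighted_gf_nth product_fibre ..
  also have "\<dots> = (\<Sum>i\<in>{0..k}. \<Sum>z\<in>{x \<in> A. f x = i} \<times> {y \<in> B. g y = k - i}. case z of (x, y) \<Rightarrow> w x * v y)"
    by (rule sum.UNION_disjoint) (use fin in auto)
  also have "\<dots> = (\<Sum>i\<in>{0..k}. (\<Sum>x | x \<in> A \<and> f x = i. w x) * (\<Sum>y | y \<in> B \<and> g y = k - i. v y))"
    by (simp add: sum_product sum.cartesian_product)
  finally show "(weighted_gf A f w * weighted_gf B g v) $ k =
      weighted_gf (A \<times> B) (\<lambda>(x, y). f x + g y) (\<lambda>(x, y). w x * v y) $ k"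
    by (simp add: fps_mult_nth weighted_gf_nth)
qed

text \<open>The Euler operator q d/dq, unlike the plain derivative, keeps exponents in place; only
  the weight changes.\<close>

lemma XD_weighted_gf: "fps_X * fps_deriv (weighted_gf A f w) = weighted_gf A f (\<lambda>x. real (f x) * w x)"
proof (rule fps_ext)
  fix k
  have "(fps_X * fps_deriv (weighted_gf A f w)) $ k = real k * weighted_gf A f w $ k"
    by (cases k) simp_all
  also have "\<dots> = (\<Sum>x | x \<in> A \<and> f x = k. real k * w x)"
    by (simp add: weighted_gf_nth sum_distrib_left)
  also have "\<dots> = (\<Sum>x | x \<in> A \<and> f x = k. real (f x) * w x)"
    by (rule sum.cong) auto
  finally show "(fps_X * fps_deriv (weighted_gf A f w)) $ k = weighted_gf A f (\<lambda>x. real (f x) * w x) $ k"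
    by (simp add: weighted_gf_nth)
qed

lemma weighted_gf_diff: "weighted_gf A f w - weighted_gf A f v = weighted_gf A f (\<lambda>x. w x - v x)"
  by (rule fps_ext) (simp add: weighted_gf_nth sum_subtractf)

lemma weighted_gf_const_mult: "fps_const c * weighted_gf A f w = weighted_gf A f (\<lambda>x. c * w x)"
  by (rule fps_ext) (simp add: weighted_gf_nth sum_distrib_left)

section \<open>Power series with equal logarithmic derivatives\<close>

text \<open>The hypothesis is F'/F = G'/G with denominators cleared. Choose \<open>c\<close> so that
  \<open>H\<close> vanishes at \<open>k\<close>, the order of \<open>G\<close>; \<open>H\<close>
  satisfies the same equation. If \<open>H\<close> had a lowest term, at \<open>h\<close>, comparing
  coefficients at \<open>h + k\<close> would give \<open>h = k\<close>, where \<open>H\<close>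
  vanishes.\<close>

lemma same_log_deriv:
  fixes F G :: "'a::field_char_0 fps"
  assumes eq: "fps_deriv F * G = F * fps_deriv G" and "G \<noteq> 0"
  shows "\<exists>c. F = fps_const c * G"
proof -
  define k where "k = subdegree G"
  define c where "c = F $ k / G $ k"
  define H where "H = F - fps_const c * G"
  have Gk: "G $ k \<noteq> 0" using \<open>G \<noteq> 0\<close> by (simp add: k_def)
  have Hk: "H $ k = 0" using Gk by (simp add: H_def c_def)
  have H: "fps_deriv H * G = H * fps_deriv G"
    using eq by (simp add: H_def algebra_simps)
  have "H = 0"
  proof (rule ccontr)
    assume "H \<noteq> 0"
    define h where "h = subdegree H"
    have Hh: "H $ h \<noteq> 0" using \<open>H \<noteq> 0\<close> by (simp add: h_def)
    define DH DG where "DH = fps_X * fps_deriv H" and "DG = fps_X * fps_deriv G"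
    have DH: "DH $ i = of_nat i * H $ i" and DG: "DG $ i = of_nat i * G $ i" for i
      unfolding DH_def DG_def by (cases i; simp)+
    have "DH * G = H * DG"
      using H unfolding DH_def DG_def by (simp add: algebra_simps)
    then have "(DH * G) $ (h + k) = (H * DG) $ (h + k)" by simp
    moreover have "(DH * G) $ (h + k) = DH $ h * G $ k"
    proof -
      have "DH $ i * G $ (h + k - i) = 0" if "i \<noteq> h" "i \<le> h + k" for i
        using that nth_less_subdegree_zero[of i H] nth_less_subdegree_zero[of "h + k - i" G]
        by (cases "i < h") (auto simp: DH h_def k_def)
      then have "(\<Sum>i=0..h+k. DH $ i * G $ (h + k - i)) =
          (\<Sum>i=0..h+k. if i = h then DH $ h * G $ k else 0)"
        by (intro sum.cong) auto
      then show ?thesis by (simp add: fps_mult_nth)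
    qed
    moreover have "(H * DG) $ (h + k) = H $ h * DG $ k"
    proof -
      have "H $ i * DG $ (h + k - i) = 0" if "i \<noteq> h" "i \<le> h + k" for i
        using that nth_less_subdegree_zero[of i H] nth_less_subdegree_zero[of "h + k - i" G]
        by (cases "i < h") (auto simp: DG h_def k_def)
      then have "(\<Sum>i=0..h+k. H $ i * DG $ (h + k - i)) =
          (\<Sum>i=0..h+k. if i = h then H $ h * DG $ k else 0)"
        by (intro sum.cong) auto
      then show ?thesis by (simp add: fps_mult_nth)
    qed
    ultimately have "of_nat h = (of_nat k :: 'a)"
      using Gk Hh by (simp add: DH DG)
    then show False using Hh Hk by simp
  qed
  then show ?thesis by (auto simp: H_def)
qed

lemma XD_same_log_deriv:
  fixes F G :: "'a::field_char_0 fps"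
  assumes "fps_X * fps_deriv F * G = F * (fps_X * fps_deriv G)" and "G \<noteq> 0"
  shows "\<exists>c. F = fps_const c * G"
proof (rule same_log_deriv)
  have "fps_X * (fps_deriv F * G) = fps_X * (F * fps_deriv G)"
    using assms(1) by (simp add: algebra_simps)
  then show "fps_deriv F * G = F * fps_deriv G" by simp
qed fact

lemma finite_fibres_square:
  assumes "c > 0"
  shows "finite_fibres A (\<lambda>x::int. nat (c * x\<^sup>2))"
  unfolding finite_fibres_def
proof
  fix k
  have "\<bar>x\<bar> \<le> int k" if "nat (c * x\<^sup>2) = k" for x
  proof -
    have "\<bar>x\<bar> * 1 \<le> \<bar>x\<bar> * \<bar>x\<bar>" by (cases "x = 0") (simp, intro mult_left_mono, auto)
    then have "\<bar>x\<bar> \<le> x\<^sup>2" by (simp add: power2_eq_square)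
    also have "\<dots> \<le> c * x\<^sup>2" using assms mult_right_mono[of 1 c "x\<^sup>2"] by simp
    finally show ?thesis using that by auto
  qed
  then have "{x \<in> A. nat (c * x\<^sup>2) = k} \<subseteq> {- int k..int k}" by auto (smt (verit))+
  then show "finite {x \<in> A. nat (c * x\<^sup>2) = k}" by (rule finite_subset) simp
qed

section \<open>Jacobi's identity for the weighted theta function\<close>

definition parity_sign :: "int \<Rightarrow> real" where
  "parity_sign u = (if even u then 1 else -1)"

text \<open>On odd arguments this is the nontrivial character modulo 4. Even arguments get -1
  instead of 0, so all sums with \<open>chi\<close> run over odd integers.\<close>

definition chi :: "int \<Rightarrow> real" where
  "chi r = (if [r = 1] (mod 4) then 1 else -1)"

lemma parity_sign_add: "parity_sign (u + v) = parity_sign u * parity_sign v"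
  by (auto simp: parity_sign_def)

lemma parity_sign_minus [simp]: "parity_sign (- u) = parity_sign u"
  by (auto simp: parity_sign_def)

text \<open>Each shift by 2 exchanges the classes 1 and 3 modulo 4, so only the parity of the number
  of shifts matters.\<close>

lemma chi_add_double:
  assumes "odd q"
  shows "chi (q + 2 * p) = chi q * parity_sign p"
proof (cases "even p")
  case True
  then obtain k where "p = 2 * k" by blast
  moreover have "[q + 4 * k = 1] (mod 4) \<longleftrightarrow> [q = 1] (mod 4)" by (simp add: cong_def)
  ultimately show ?thesis by (simp add: chi_def parity_sign_def)
next
  case False
  then obtain k where "p = 2 * k + 1" by (rule oddE)
  moreover have "[q + 2 * (2 * k + 1) = 1] (mod 4) \<longleftrightarrow> \<not> [q = 1] (mod 4)"
  proof -
    have "(q + 2 * (2 * k + 1)) mod 4 = (q + 2 + 4 * k) mod 4" by (simp add: algebra_simps)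
    also have "\<dots> = (q + 2) mod 4" by simp
    finally have "[q + 2 * (2 * k + 1) = 1] (mod 4) \<longleftrightarrow> (q + 2) mod 4 = 1" by (simp add: cong_def)
    also have "\<dots> \<longleftrightarrow> \<not> q mod 4 = 1" using \<open>odd q\<close> by presburger
    finally show ?thesis by (simp add: cong_def)
  qed
  ultimately show ?thesis by (simp add: chi_def parity_sign_def)
qed

text \<open>\<open>q\<close> arises from \<open>- q\<close> by \<open>q\<close> shifts by 2, an odd
  number.\<close>

lemma chi_minus: "odd q \<Longrightarrow> chi (- q) = - chi q"
  using chi_add_double[of "-q" q] chi_add_double[of "q" "-q"] by (simp add: parity_sign_def)

lemma finite_int_square_bounded:
  assumes "c > 0"
  shows "finite {x::int. c * x\<^sup>2 \<le> k}"
proof -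
  have "finite_fibres UNIV (\<lambda>x::int. nat (c * x\<^sup>2))" by (rule finite_fibres_square) fact
  then have "finite (\<Union>j\<in>{0..nat k}. {x::int. nat (c * x\<^sup>2) = j})"
    by (simp add: finite_fibres_def)
  then show ?thesis
    by (rule rev_finite_subset) auto
qed

lemma finite_three_squares:
  assumes "a > 0" "b > 0" "c > 0"
  shows "finite {(x::int, y::int, z::int). P x y z \<and> a * x\<^sup>2 + b * y\<^sup>2 + c * z\<^sup>2 = k}"
proof (rule finite_subset)
  show "{(x::int, y::int, z::int). P x y z \<and> a * x\<^sup>2 + b * y\<^sup>2 + c * z\<^sup>2 = k} \<subseteq>
      {x. a * x\<^sup>2 \<le> k} \<times> {y. b * y\<^sup>2 \<le> k} \<times> {z. c * z\<^sup>2 \<le> k}"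
  proof
    fix w assume "w \<in> {(x::int, y::int, z::int). P x y z \<and> a * x\<^sup>2 + b * y\<^sup>2 + c * z\<^sup>2 = k}"
    then obtain x y z where w: "w = (x, y, z)" "a * x\<^sup>2 + b * y\<^sup>2 + c * z\<^sup>2 = k" by auto
    have "0 \<le> a * x\<^sup>2" "0 \<le> b * y\<^sup>2" "0 \<le> c * z\<^sup>2" using assms by auto
    with w show "w \<in> {x. a * x\<^sup>2 \<le> k} \<times> {y. b * y\<^sup>2 \<le> k} \<times> {z. c * z\<^sup>2 \<le> k}" by simp
  qed
qed (intro finite_cartesian_product finite_int_square_bounded assms)

text \<open>
  Up to the sign of \<open>x\<close> we have \<open>r = q + 2 p\<close> and \<open>x = q - 2 p\<close> with \<open>q\<close> odd. The quadratic form
  becomes \<open>2 q\<^sup>2 + 8 p\<^sup>2 + 8 u\<^sup>2\<close>, and the average of the summand over \<open>\<plusminus>p\<close> is antisymmetric under the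
  exchange of \<open>p\<close> and \<open>u\<close>.
\<close>
lemma cubic_theta_sum_vanishes:
  fixes k :: int
  shows "(\<Sum>(r, x, u) | odd r \<and> odd x \<and> r\<^sup>2 + x\<^sup>2 + 8 * u\<^sup>2 = k.
      chi r * r * parity_sign u * (r\<^sup>2 - x\<^sup>2 - 16 * u\<^sup>2)) = 0"
proof -
  define w :: "int \<times> int \<times> int \<Rightarrow> real"
    where "w = (\<lambda>(r, x, u). chi r * r * parity_sign u * (r\<^sup>2 - x\<^sup>2 - 16 * u\<^sup>2))"
  define T where "T = {(r, x, u). odd r \<and> odd x \<and> r\<^sup>2 + x\<^sup>2 + 8 * u\<^sup>2 = k}"
  define T1 where "T1 = {(r, x, u). (r, x, u) \<in> T \<and> 4 dvd r - x}"
  define T2 where "T2 = {(r, x, u). (r, x, u) \<in> T \<and> \<not> 4 dvd r - x}"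
  define V where "V = {(q, p, u). odd q \<and> 2 * q\<^sup>2 + 8 * p\<^sup>2 + 8 * u\<^sup>2 = k}"
  define v :: "int \<times> int \<times> int \<Rightarrow> real"
    where "v = (\<lambda>(q, p, u). w (q + 2 * p, q - 2 * p, u))"
  have "finite T" unfolding T_def
    using finite_three_squares[of 1 1 8 "\<lambda>r x u. odd r \<and> odd x" k] by (simp add: conj_assoc)
  then have fin: "finite T1" "finite T2"
    by (auto simp: T1_def T2_def intro: finite_subset)
  have T12: "sum w T = sum w T1 + sum w T2"
    by (subst sum.union_disjoint[symmetric])
      (use fin in \<open>auto simp: T1_def T2_def intro!: arg_cong[of _ _ "sum w"]\<close>)
  \<comment> \<open>Both numbers are even and differ by \<open>2 * x\<close>, which is 2 modulo 4.
    Hence changing the sign of \<open>x\<close> exchanges \<open>T1\<close> and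
    \<open>T2\<close>.\<close>
  have dvd4: "4 dvd r + x \<longleftrightarrow> \<not> 4 dvd r - x" if "odd r" "odd x" for r x :: int
    using that by presburger
  have "sum w T2 = sum w T1"
  proof (rule sum.reindex_bij_witness[of _ "\<lambda>(r, x, u). (r, - x, u)" "\<lambda>(r, x, u). (r, - x, u)"])
    fix z assume "z \<in> T2"
    then show "(case z of (r, x, u) \<Rightarrow> (r, - x, u)) \<in> T1"
      by (auto simp: T1_def T2_def T_def dvd4)
  next
    fix z assume "z \<in> T1"
    then show "(case z of (r, x, u) \<Rightarrow> (r, - x, u)) \<in> T2"
      by (auto simp: T1_def T2_def T_def dvd4)
  qed (auto simp: w_def)
  moreover have "sum w T1 = sum v V"
  proof (rule sum.reindex_bij_witness[of _ "\<lambda>(q, p, u). (q + 2 * p, q - 2 * p, u)"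
        "\<lambda>(r, x, u). ((r + x) div 2, (r - x) div 4, u)"])
    fix z assume z: "z \<in> T1"
    obtain r x u where [simp]: "z = (r, x, u)" by (cases z)
    from z obtain p where p: "r - x = 4 * p" by (auto simp: T1_def elim: dvdE)
    define q where "q = x + 2 * p"
    have rx: "r = q + 2 * p" "x = q - 2 * p" using p by (auto simp: q_def)
    from z show "(case case z of (r, x, u) \<Rightarrow> ((r + x) div 2, (r - x) div 4, u) of
        (q, p, u) \<Rightarrow> (q + 2 * p, q - 2 * p, u)) = z"
      by (simp add: rx)
    from z show "(case z of (r, x, u) \<Rightarrow> ((r + x) div 2, (r - x) div 4, u)) \<in> V"
      by (simp add: rx T1_def T_def V_def) (simp add: power2_eq_square algebra_simps)
    from z show "v (case z of (r, x, u) \<Rightarrow> ((r + x) div 2, (r - x) div 4, u)) = w z"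
      by (simp add: rx v_def)
  next
    fix z assume "z \<in> V"
    then show "(case z of (q, p, u) \<Rightarrow> (q + 2 * p, q - 2 * p, u)) \<in> T1"
      by (auto simp: T1_def T_def V_def) (simp add: power2_eq_square algebra_simps)
  qed auto
  moreover have "sum v V = 0"
  proof -
    have neg: "sum v V = sum (\<lambda>(q, p, u). v (q, - p, u)) V"
      by (rule sum.reindex_bij_witness[of _ "\<lambda>(q, p, u). (q, - p, u)" "\<lambda>(q, p, u). (q, - p, u)"])
        (auto simp: V_def)
    have swap: "sum v' V = sum (\<lambda>(q, p, u). v' (q, u, p)) V" for v' :: "_ \<Rightarrow> real"
      by (rule sum.reindex_bij_witness[of _ "\<lambda>(q, p, u). (q, u, p)" "\<lambda>(q, p, u). (q, u, p)"])
        (auto simp: V_def)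
    define s where "s = (\<lambda>(q, p, u). v (q, p, u) + v (q, - p, u))"
    \<comment> \<open>With \<open>r = q + 2 * p\<close> and \<open>x = q - 2 * p\<close> one has r^2
      - x^2 = 8 q p and \<open>chi r = chi q * parity_sign p\<close>. Thus
      \<open>s (q, p, u)\<close> is 32 \<open>chi q * q * parity_sign p * parity_sign u\<close>
      times (p^2 - u^2).\<close>
    have s: "s (q, u, p) = - s (q, p, u)" if "odd q" for q p u
      using chi_add_double[OF that, of p] chi_add_double[OF that, of "-p"]
        chi_add_double[OF that, of u] chi_add_double[OF that, of "-u"]
      by (simp add: s_def v_def w_def) (simp add: power2_eq_square algebra_simps)
    have "2 * sum v V = sum s V"
      by (subst mult_2, subst (2) neg, subst sum.distrib[symmetric])
        (auto simp: s_def intro!: sum.cong)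
    moreover have "sum s V = - sum s V"
    proof -
      have "sum s V = sum (\<lambda>(q, p, u). s (q, u, p)) V" by (rule swap)
      also have "\<dots> = sum (\<lambda>z. - s z) V"
      proof (rule sum.cong)
        fix z assume "z \<in> V"
        then obtain q p u where z: "z = (q, p, u)" and "odd q" by (auto simp: V_def)
        then show "(case z of (q, p, u) \<Rightarrow> s (q, u, p)) = - s z"
          unfolding z prod.case by (intro s)
      qed simp
      finally show ?thesis unfolding sum_negf .
    qed
    ultimately show ?thesis by linarith
  qed
  ultimately show ?thesis using T12 by (simp add: T_def w_def)
qed

text \<open>In Jacobi's notation, \<open>theta_odd\<close> is theta_2 and \<open>theta_chi\<close>
  is theta_1'(0), both at nome q^4, while \<open>theta_alt\<close> is theta_4 at nome q^8.\<close>

definition theta_odd :: "real fps" where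
  "theta_odd = weighted_gf {x. odd x} (\<lambda>x::int. nat (x\<^sup>2)) (\<lambda>_. 1)"

definition theta_alt :: "real fps" where
  "theta_alt = weighted_gf UNIV (\<lambda>u::int. nat (8 * u\<^sup>2)) parity_sign"

definition theta_chi :: "real fps" where
  "theta_chi = weighted_gf {r. odd r} (\<lambda>r::int. nat (r\<^sup>2)) (\<lambda>r. chi r * r)"

lemma odd_square_eq_1_iff: "odd r \<and> nat (r\<^sup>2) = 1 \<longleftrightarrow> r = 1 \<or> r = (-1::int)"
  by (auto simp: power2_eq_1_iff nat_eq_iff)

lemma theta_odd_1: "theta_odd $ 1 = 2"
proof -
  have "{r::int. odd r \<and> nat (r\<^sup>2) = 1} = {1, -1}"
    using odd_square_eq_1_iff by auto
  then show ?thesis by (simp add: theta_odd_def weighted_gf_nth)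
qed

lemma theta_odd_0: "theta_odd $ 0 = 0"
proof -
  have "{r::int. odd r \<and> nat (r\<^sup>2) = 0} = {}" by auto
  then show ?thesis by (simp add: theta_odd_def weighted_gf_nth)
qed

lemma theta_alt_0: "theta_alt $ 0 = 1"
proof -
  have "{u::int. nat (8 * u\<^sup>2) = 0} = {0}" by auto
  then show ?thesis by (simp add: theta_alt_def weighted_gf_nth parity_sign_def)
qed

lemma theta_chi_1: "theta_chi $ 1 = 2"
proof -
  have "{r::int. odd r \<and> nat (r\<^sup>2) = 1} = {1, -1}"
    using odd_square_eq_1_iff by auto
  then show ?thesis by (simp add: theta_chi_def weighted_gf_nth chi_def cong_def)
qed

lemma finite_fibres_sq: "finite_fibres A (\<lambda>x::int. nat (x\<^sup>2))"
  using finite_fibres_square[of 1 A] by simp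

lemmas finite_fibres_intros = finite_fibres_sq finite_fibres_square finite_fibres_Times

text \<open>This is Jacobi's theta_1' = theta_2 theta_3 theta_4 at nome q^4, combined with
  theta_3(q) theta_4(q) = theta_4(q^2)^2.\<close>

lemma theta_chi_eq: "theta_chi = theta_odd * theta_alt\<^sup>2"
proof -
  let ?D = "\<lambda>F. fps_X * fps_deriv F"
  let ?f = "\<lambda>(r::int, x::int, u::int). nat (r\<^sup>2) + (case (x, u) of (x, u) \<Rightarrow> nat (x\<^sup>2) + nat (8 * u\<^sup>2))"
  let ?A = "{r::int. odd r} \<times> {x::int. odd x} \<times> (UNIV :: int set)"
  \<comment> \<open>The logarithmic derivatives are compared after multiplication by one copy of
    each series. The exponents r^2, x^2 and 8 u^2, the last one doubled by the square on
    \<open>theta_alt\<close>, form the cubic weight.\<close>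
  have "?D theta_chi * (theta_odd * theta_alt) - theta_chi * (?D theta_odd * theta_alt) - fps_const 2 * (theta_chi * (theta_odd * ?D theta_alt)) =
      weighted_gf ?A ?f (\<lambda>(r, x, u). chi r * r * parity_sign u * (r\<^sup>2 - x\<^sup>2 - 16 * u\<^sup>2))"
    unfolding theta_odd_def theta_alt_def theta_chi_def XD_weighted_gf
    apply (subst weighted_gf_mult, (intro finite_fibres_intros; simp; fail)+)+
    apply (simp only: weighted_gf_const_mult weighted_gf_diff)
    apply (rule weighted_gf_cong; clarsimp simp: algebra_simps)
    done
  also have "\<dots> = 0"
  proof (rule fps_ext)
    fix k
    have "{z. z \<in> ?A \<and> ?f z = k} = {(r, x, u). odd r \<and> odd x \<and> r\<^sup>2 + x\<^sup>2 + 8 * u\<^sup>2 = int k}"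
      by (auto simp: nat_add_distrib[symmetric] nat_eq_iff)
    then show "weighted_gf ?A ?f (\<lambda>(r, x, u). chi r * r * parity_sign u * (r\<^sup>2 - x\<^sup>2 - 16 * u\<^sup>2)) $ k = 0 $ k"
      unfolding weighted_gf_nth using cubic_theta_sum_vanishes[of "int k"] by (simp add: case_prod_unfold)
  qed
  finally have *: "?D theta_chi * (theta_odd * theta_alt) = theta_chi * (?D theta_odd * theta_alt + fps_const 2 * (theta_odd * ?D theta_alt))"
    by (simp add: algebra_simps)
  have "theta_odd \<noteq> 0" "theta_alt \<noteq> 0" using theta_odd_1 theta_alt_0 by auto
  have const2: "fps_const 2 = (2 :: real fps)" by (simp add: numeral_fps_const)
  have "?D theta_chi * (theta_odd * theta_alt\<^sup>2) = (?D theta_chi * (theta_odd * theta_alt)) * theta_alt"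
    by (simp add: power2_eq_square algebra_simps)
  also have "\<dots> = theta_chi * (?D (theta_odd * theta_alt\<^sup>2))"
    unfolding * const2 by (simp add: power2_eq_square algebra_simps)
  finally have "\<exists>c. theta_chi = fps_const c * (theta_odd * theta_alt\<^sup>2)"
    using \<open>theta_odd \<noteq> 0\<close> \<open>theta_alt \<noteq> 0\<close> by (intro XD_same_log_deriv) auto
  then obtain c where c: "theta_chi = fps_const c * (theta_odd * theta_alt\<^sup>2)" ..
  \<comment> \<open>The lowest terms, at exponent 1, determine the constant.\<close>
  have "(theta_odd * theta_alt\<^sup>2) $ 1 = 2"
    using theta_odd_0 theta_odd_1 theta_alt_0 by (simp add: fps_mult_nth_1 power2_eq_square)
  moreover have "theta_chi $ 1 = c * (theta_odd * theta_alt\<^sup>2) $ 1"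
    by (subst c) (rule fps_mult_left_const_nth)
  ultimately have "c = 1" using theta_chi_1 by simp
  then show ?thesis using c by simp
qed

section \<open>Indefinite binary quadratic forms and the fourth power\<close>

text \<open>A triple stands for the form a X^2 + b X Y + c Y^2 of discriminant \<open>K\<close>. The
  opposite signs of \<open>a\<close> and \<open>c\<close> leave only finitely many.\<close>

definition odd_forms :: "int \<Rightarrow> (int \<times> int \<times> int) set" where
  "odd_forms K = {(a, b, c). odd a \<and> odd b \<and> odd c \<and> a > 0 \<and> c < 0 \<and> b\<^sup>2 - 4 * a * c = K}"

lemma finite_odd_forms: "finite (odd_forms K)"
proof (rule finite_subset)
  show "odd_forms K \<subseteq> {0..K} \<times> {b. 1 * b\<^sup>2 \<le> K} \<times> {- K..0}"
  proof
    fix z assume "z \<in> odd_forms K"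
    then obtain a b c where z: "z = (a, b, c)" and ac: "a \<ge> 1" "- c \<ge> 1" and K: "b\<^sup>2 - 4 * a * c = K"
      by (auto simp: odd_forms_def)
    have "a * 1 \<le> a * (- c)" "1 * (- c) \<le> a * (- c)"
      by (rule mult_left_mono mult_right_mono; use ac in simp)+
    moreover have "b\<^sup>2 \<ge> 0" by simp
    moreover have "b\<^sup>2 + 4 * (a * (- c)) = K" using K by (simp add: algebra_simps)
    ultimately have "a \<le> K" "- c \<le> K" "b\<^sup>2 \<le> K" using ac by linarith+
    then show "z \<in> {0..K} \<times> {b. 1 * b\<^sup>2 \<le> K} \<times> {- K..0}" using z ac by simp
  qed
qed (intro finite_cartesian_product finite_int_square_bounded; simp)

text \<open>
  The odd term \<open>a\<^sup>2 b\<close> sums to zero and may be added. The map \<open>(a, b, c) \<mapsto> (-c, -b, -a)\<close> then reduces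
  the sum to forms with \<open>a + b + c < 0\<close>, where the summand becomes \<open>(a - c) (a + b) (b + c)\<close>. The
  change of variables that sends \<open>(a, b, c)\<close> to \<open>(a, -b - 2 a, a + b + c)\<close> is an involution on these
  forms and reverses the sign of this product.
\<close>
lemma odd_forms_sum:
  "(\<Sum>(a, b, c)\<in>odd_forms K. a\<^sup>2 * c + a * b\<^sup>2) = 0"
proof -
  define F :: "int \<times> int \<times> int \<Rightarrow> int"
    where "F = (\<lambda>(a, b, c). a\<^sup>2 * c + a * b\<^sup>2 + a\<^sup>2 * b)"
  define p :: "int \<times> int \<times> int \<Rightarrow> int"
    where "p = (\<lambda>(a, b, c). (a - c) * (a + b) * (b + c))"
  define M where "M = odd_forms K"
  define Mneg where "Mneg = {(a, b, c). (a, b, c) \<in> M \<and> a + b + c < 0}"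
  define Mpos where "Mpos = {(a, b, c). (a, b, c) \<in> M \<and> a + b + c > 0}"
  have fin: "finite M" by (simp add: M_def finite_odd_forms)
  have "Mneg \<subseteq> M" "Mpos \<subseteq> M" by (auto simp: Mneg_def Mpos_def)
  then have fin': "finite Mneg" "finite Mpos" using fin finite_subset by blast+
  have M_split: "M = Mneg \<union> Mpos"
  proof -
    have "a + b + c \<noteq> 0" if "(a, b, c) \<in> M" for a b c
      using that by (auto simp: M_def odd_forms_def) presburger
    then show ?thesis by (force simp: Mneg_def Mpos_def)
  qed
  have "(\<Sum>(a, b, c)\<in>M. a\<^sup>2 * b) = (\<Sum>(a, b, c)\<in>M. - (a\<^sup>2 * b))"
    by (rule sum.reindex_bij_witness[of _ "\<lambda>(a, b, c). (a, - b, c)" "\<lambda>(a, b, c). (a, - b, c)"])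
      (auto simp: M_def odd_forms_def)
  also have "\<dots> = - (\<Sum>(a, b, c)\<in>M. a\<^sup>2 * b)"
    by (simp add: sum_negf case_prod_unfold)
  finally have "(\<Sum>(a, b, c)\<in>M. a\<^sup>2 * b) = 0" by linarith
  then have "(\<Sum>(a, b, c)\<in>M. a\<^sup>2 * c + a * b\<^sup>2) = sum F M"
    by (simp add: F_def case_prod_unfold sum.distrib)
  also have "\<dots> = sum F Mneg + sum F Mpos"
    unfolding M_split by (rule sum.union_disjoint) (use fin' in \<open>auto simp: Mneg_def Mpos_def\<close>)
  also have "sum F Mpos = sum (\<lambda>(a, b, c). F (- c, - b, - a)) Mneg"
    by (rule sum.reindex_bij_witness[of _ "\<lambda>(a, b, c). (- c, - b, - a)" "\<lambda>(a, b, c). (- c, - b, - a)"])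
      (auto simp: M_def Mneg_def Mpos_def odd_forms_def algebra_simps)
  also have "sum F Mneg + sum (\<lambda>(a, b, c). F (- c, - b, - a)) Mneg = sum p Mneg"
    unfolding sum.distrib[symmetric]
    by (rule sum.cong) (auto simp: F_def p_def power2_eq_square algebra_simps)
  also have "\<dots> = 0"
  proof -
    \<comment> \<open>The new last coefficient is \<open>a + b + c\<close>, negative on
      \<open>Mneg\<close>, and the new coefficient sum is \<open>c\<close>. The factors
      \<open>a - c\<close>, \<open>a + b\<close>, \<open>b + c\<close> become
      \<open>- (b + c)\<close>, \<open>- (a + b)\<close>, \<open>- (a - c)\<close>.\<close>
    have "sum p Mneg = sum (\<lambda>z. - p z) Mneg"
      by (rule sum.reindex_bij_witness[of _ "\<lambda>(a, b, c). (a, - b - 2 * a, a + b + c)"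
            "\<lambda>(a, b, c). (a, - b - 2 * a, a + b + c)"])
        (auto simp: M_def Mneg_def odd_forms_def p_def power2_eq_square algebra_simps)
    then show ?thesis unfolding sum_negf by linarith
  qed
  finally show ?thesis by (simp add: M_def)
qed

section \<open>The divisor-sum series and the fourth power of theta\<close>

definition odd_pos :: "int set" where
  "odd_pos = {d. odd d \<and> d > 0}"

text \<open>A divisor \<open>d\<close> is recorded with its cofactor \<open>e\<close>, so that the
  exponent 4 d e plus a square x^2 becomes the discriminant of the form with coefficients
  \<open>d\<close>, \<open>x\<close>, \<open>- e\<close>.\<close>

definition sigma_series :: "real fps" where
  "sigma_series = weighted_gf (odd_pos \<times> odd_pos) (\<lambda>(d, e). nat (4 * d * e)) (\<lambda>(d, e). d)"

lemma finite_fibres_sigma_series: "finite_fibres (odd_pos \<times> odd_pos) (\<lambda>(d, e). nat (4 * d * e))"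
  unfolding finite_fibres_def
proof
  fix k
  have "{z \<in> odd_pos \<times> odd_pos. (case z of (d, e) \<Rightarrow> nat (4 * d * e)) = k} \<subseteq> {0..int k} \<times> {0..int k}"
  proof
    fix z assume "z \<in> {z \<in> odd_pos \<times> odd_pos. (case z of (d, e) \<Rightarrow> nat (4 * d * e)) = k}"
    then obtain d e where z: "z = (d, e)" and de: "d \<ge> 1" "e \<ge> 1" and k: "nat (4 * d * e) = k"
      by (auto simp: odd_pos_def)
    have "d * 1 \<le> d * e" "1 * e \<le> d * e"
      by (rule mult_left_mono mult_right_mono; use de in simp)+
    moreover have "int k = 4 * (d * e)" using de unfolding k[symmetric] by simp
    ultimately have "d \<le> int k" "e \<le> int k" using de by linarith+
    then show "z \<in> {0..int k} \<times> {0..int k}" using z de by simp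
  qed
  then show "finite {z \<in> odd_pos \<times> odd_pos. (case z of (d, e) \<Rightarrow> nat (4 * d * e)) = k}"
    by (rule finite_subset) simp
qed

lemma sigma_series_nth:
  "sigma_series $ (4 * m) = (\<Sum>(d, e) | d \<in> odd_pos \<and> e \<in> odd_pos \<and> d * e = int m. real_of_int d)"
proof -
  have "{z \<in> odd_pos \<times> odd_pos. (case z of (d, e) \<Rightarrow> nat (4 * d * e)) = 4 * m} =
      {(d, e). d \<in> odd_pos \<and> e \<in> odd_pos \<and> d * e = int m}"
    by (auto simp: odd_pos_def nat_eq_iff)
  then show ?thesis by (simp add: sigma_series_def weighted_gf_nth case_prod_unfold)
qed

text \<open>This is Legendre's theorem on sums of four triangular numbers. With (a, b, c) = (d, x,
  -e), the weight 4 (d^2 e - d x^2) from the comparison of logarithmic derivatives is -4 (a^2 c + a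
  b^2), which \<open>odd_forms_sum\<close> annihilates.\<close>

lemma theta_odd_power4: "theta_odd ^ 4 = fps_const 16 * sigma_series"
proof -
  let ?D = "\<lambda>F. fps_X * fps_deriv F"
  let ?A = "(odd_pos \<times> odd_pos) \<times> {x::int. odd x}"
  let ?f = "\<lambda>((d, e), x). nat (4 * d * e) + nat (x\<^sup>2)"
  let ?w = "\<lambda>((d, e), x). real_of_int (4 * (d\<^sup>2 * e - d * x\<^sup>2))"
  have "?D sigma_series * theta_odd - fps_const 4 * (sigma_series * ?D theta_odd) = weighted_gf ?A ?f ?w"
    unfolding theta_odd_def sigma_series_def XD_weighted_gf
    apply (subst weighted_gf_mult, (intro finite_fibres_intros finite_fibres_sigma_series; simp; fail)+)+
    apply (simp only: weighted_gf_const_mult weighted_gf_diff)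
    apply (rule weighted_gf_cong; clarsimp simp: algebra_simps power2_eq_square odd_pos_def)
    done
  also have "\<dots> = 0"
  proof (rule fps_ext)
    fix k
    have fibre: "nat (4 * d * e) + nat (x\<^sup>2) = k \<longleftrightarrow> x\<^sup>2 + 4 * d * e = int k"
      if "d > 0" "e > 0" for d e x :: int
    proof -
      have "4 * d * e \<ge> 0" using that by simp
      then have "int (nat (4 * d * e) + nat (x\<^sup>2)) = x\<^sup>2 + 4 * d * e" by simp
      then show ?thesis by linarith
    qed
    have "(\<Sum>z | z \<in> ?A \<and> ?f z = k. ?w z) =
        (\<Sum>(a, b, c)\<in>odd_forms (int k). real_of_int (- 4 * (a\<^sup>2 * c + a * b\<^sup>2)))"
      by (rule sum.reindex_bij_witness[of _ "\<lambda>(a, b, c). ((a, - c), b)" "\<lambda>((d, e), x). (d, x, - e)"])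
        (use fibre[of _ "- _"] in \<open>auto simp: odd_forms_def odd_pos_def fibre\<close>)
    also have "\<dots> = real_of_int (- 4 * (\<Sum>(a, b, c)\<in>odd_forms (int k). a\<^sup>2 * c + a * b\<^sup>2))"
      by (simp only: case_prod_unfold of_int_sum sum_distrib_left)
    also have "\<dots> = 0" unfolding odd_forms_sum by simp
    finally show "weighted_gf ?A ?f ?w $ k = 0 $ k" by (simp add: weighted_gf_nth)
  qed
  finally have *: "?D sigma_series * theta_odd = sigma_series * (fps_const 4 * ?D theta_odd)"
    by (simp add: algebra_simps)
  have const4: "fps_const 4 = (4 :: real fps)" by (simp add: numeral_fps_const)
  have "?D sigma_series * theta_odd ^ 4 = (?D sigma_series * theta_odd) * theta_odd ^ 3"
    by (simp add: eval_nat_numeral algebra_simps)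
  also have "\<dots> = sigma_series * ?D (theta_odd ^ 4)"
    unfolding * const4 by (simp add: eval_nat_numeral algebra_simps)
  finally have "\<exists>c. sigma_series = fps_const c * theta_odd ^ 4"
    using theta_odd_1 by (intro XD_same_log_deriv) auto
  then obtain c where c: "sigma_series = fps_const c * theta_odd ^ 4" ..
  \<comment> \<open>Splitting off one factor \<open>fps_X\<close> leaves constant term 2, so the
    fourth power starts with 2^4 at exponent 4.\<close>
  define P where "P = fps_shift 1 theta_odd"
  have "theta_odd = fps_X * P"
  proof (rule fps_ext)
    show "theta_odd $ k = (fps_X * P) $ k" for k
      using theta_odd_0 by (cases k) (simp_all add: P_def)
  qed
  then have "theta_odd ^ 4 = fps_X ^ 4 * P ^ 4" by (metis power_mult_distrib)
  then have "(theta_odd ^ 4) $ 4 = (P ^ 4) $ 0" by (simp add: fps_X_power_mult_nth)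
  also have "\<dots> = 16" using theta_odd_1 by (simp add: fps_nth_power_0 P_def)
  finally have "(theta_odd ^ 4) $ 4 = 16" .
  moreover have "sigma_series $ 4 = 1"
  proof -
    have "{(d, e). d \<in> odd_pos \<and> e \<in> odd_pos \<and> d * e = int 1} = {(1, 1)}"
      by (auto simp: odd_pos_def zmult_eq_1_iff)
    then show ?thesis using sigma_series_nth[of 1] by simp
  qed
  moreover have "sigma_series $ 4 = c * (theta_odd ^ 4) $ 4"
    by (subst c) (rule fps_mult_left_const_nth)
  ultimately have "16 * c = 1" by simp
  moreover have "fps_const 16 * sigma_series = fps_const (16 * c) * theta_odd ^ 4"
    unfolding c mult.assoc[symmetric] fps_const_mult ..
  ultimately show ?thesis by simp
qed

section \<open>Sums of four squares\<close>

lemma finite_four_squares: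
  "finite {(x::int, y::int, z::int, w::int). x\<^sup>2 + y\<^sup>2 + z\<^sup>2 + w\<^sup>2 \<le> k}"
proof (rule finite_subset)
  let ?B = "{x::int. 1 * x\<^sup>2 \<le> k}"
  show "{(x::int, y::int, z::int, w::int). x\<^sup>2 + y\<^sup>2 + z\<^sup>2 + w\<^sup>2 \<le> k} \<subseteq> ?B \<times> ?B \<times> ?B \<times> ?B"
  proof
    fix t assume "t \<in> {(x::int, y::int, z::int, w::int). x\<^sup>2 + y\<^sup>2 + z\<^sup>2 + w\<^sup>2 \<le> k}"
    then obtain x y z w where t: "t = (x, y, z, w)" "x\<^sup>2 + y\<^sup>2 + z\<^sup>2 + w\<^sup>2 \<le> k" by auto
    have "0 \<le> x\<^sup>2" "0 \<le> y\<^sup>2" "0 \<le> z\<^sup>2" "0 \<le> w\<^sup>2" by simp_all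
    with t(2) have "x\<^sup>2 \<le> k" "y\<^sup>2 \<le> k" "z\<^sup>2 \<le> k" "w\<^sup>2 \<le> k" by linarith+
    then show "t \<in> ?B \<times> ?B \<times> ?B \<times> ?B" using t(1) by simp
  qed
qed (intro finite_cartesian_product finite_int_square_bounded; simp)

text \<open>Divisors and cofactors of an odd number are odd, so the pairs in the series correspond
  to all divisors.\<close>

lemma sigma_series_nth_eq_sigma:
  assumes "odd N"
  shows "sigma_series $ (4 * N) = real (sigma N)"
proof -
  have "N > 0" using assms by (auto intro: Nat.gr0I)
  have "sigma_series $ (4 * N) = (\<Sum>d | d dvd N. real d)"
    unfolding sigma_series_nth
  proof (rule sum.reindex_bij_witness[of _ "\<lambda>d. (int d, int (N div d))" "\<lambda>(d, e). nat d"])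
    fix z :: "int \<times> int" assume "z \<in> {(d, e). d \<in> odd_pos \<and> e \<in> odd_pos \<and> d * e = int N}"
    then obtain d e where z: "z = (d, e)" and "d > 0" "e > 0" and de: "d * e = int N"
      by (auto simp: odd_pos_def)
    then have pos: "d = int (nat d)" "e = int (nat e)" by auto
    have N: "N = nat d * nat e" using de \<open>d > 0\<close> by (simp add: nat_mult_distrib[symmetric])
    show "(case case z of (d, e) \<Rightarrow> nat d of d \<Rightarrow> (int d, int (N div d))) = z"
      using \<open>d > 0\<close> \<open>e > 0\<close> by (simp add: z N)
    show "(case z of (d, e) \<Rightarrow> nat d) \<in> {d. d dvd N}" by (simp add: z N)
    show "real (case z of (d, e) \<Rightarrow> nat d) = (case z of (d, e) \<Rightarrow> real_of_int d)"
      using \<open>d > 0\<close> by (simp add: z)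
  next
    fix d assume "d \<in> {d. d dvd N}"
    then have "d dvd N" by simp
    then have "odd d" "odd (N div d)" "d > 0" "N div d > 0" "d * (N div d) = N"
      using assms \<open>N > 0\<close> by (auto elim!: dvdE)
    moreover from this(5) have "int d * int (N div d) = int N" unfolding of_nat_mult[symmetric] by simp
    ultimately show "(int d, int (N div d)) \<in> {(d, e). d \<in> odd_pos \<and> e \<in> odd_pos \<and> d * e = int N}"
      by (simp add: odd_pos_def)
  qed auto
  then show ?thesis by (simp add: sigma_def)
qed

lemma card_four_odd_squares:
  assumes "odd N"
  shows "card {(a::int, b::int, c::int, d::int). odd a \<and> odd b \<and> odd c \<and> odd d \<and>
      a\<^sup>2 + b\<^sup>2 + c\<^sup>2 + d\<^sup>2 = 4 * int N} = 16 * sigma N"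
proof -
  let ?O = "{x::int. odd x}"
  let ?f = "\<lambda>(a::int, b::int, c::int, d::int). nat (a\<^sup>2) + (nat (b\<^sup>2) + (nat (c\<^sup>2) + nat (d\<^sup>2)))"
  have "theta_odd ^ 4 = theta_odd * (theta_odd * (theta_odd * theta_odd))" by (simp add: eval_nat_numeral)
  also have "\<dots> = weighted_gf (?O \<times> ?O \<times> ?O \<times> ?O) ?f (\<lambda>_. 1)"
    unfolding theta_odd_def
    apply (subst weighted_gf_mult, (intro finite_fibres_intros; simp; fail)+)+
    apply (rule weighted_gf_cong; clarsimp)
    done
  finally have "(theta_odd ^ 4) $ (4 * N) = real (card {z \<in> ?O \<times> ?O \<times> ?O \<times> ?O. ?f z = 4 * N})"
    by (simp add: weighted_gf_nth)
  also have "{z \<in> ?O \<times> ?O \<times> ?O \<times> ?O. ?f z = 4 * N} =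
      {(a::int, b::int, c::int, d::int). odd a \<and> odd b \<and> odd c \<and> odd d \<and>
      a\<^sup>2 + b\<^sup>2 + c\<^sup>2 + d\<^sup>2 = 4 * int N}"
    by (auto simp: nat_add_distrib[symmetric] nat_eq_iff add.assoc)
  finally show ?thesis
    using sigma_series_nth_eq_sigma[OF assms] by (simp add: theta_odd_power4 fps_mult_left_const_nth)
qed

lemma sq_mod4: "(x::int)\<^sup>2 mod 4 = (if odd x then 1 else 0)"
proof (cases "odd x")
  case True
  then obtain k where "x = 2 * k + 1" by (rule oddE)
  then have "x\<^sup>2 = 4 * (k * k + k) + 1" by (simp add: power2_eq_square algebra_simps)
  then have "x\<^sup>2 mod 4 = 1" by presburger
  then show ?thesis using True by simp
next
  case False
  then obtain k where "x = 2 * k" by (auto elim: evenE)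
  then have "x\<^sup>2 = 4 * (k * k)" by (simp add: power2_eq_square algebra_simps)
  then show ?thesis using False by simp
qed

lemma odd_sq_mod8:
  assumes "odd (x::int)"
  shows "x\<^sup>2 mod 8 = 1"
proof -
  obtain k where k: "x = 2 * k + 1" using assms by (rule oddE)
  have "even (k * k + k)" by simp
  then obtain j where "k * k + k = 2 * j" by (rule evenE)
  then have "x\<^sup>2 = 8 * j + 1" using k by (simp add: power2_eq_square algebra_simps)
  then show ?thesis by simp
qed

text \<open>
  The Hadamard matrix of order 4 maps the representations of \<open>N\<close> bijectively to those
  representations of \<open>4 N\<close> by odd squares whose roots have a sum divisible by 4, and these are
  half of all representations of \<open>4 N\<close> by odd squares.
\<close>
lemma card_four_squares:
  assumes "odd N"
  shows "card {(x::int, y::int, z::int, w::int). x\<^sup>2 + y\<^sup>2 + z\<^sup>2 + w\<^sup>2 = int N} = 8 * sigma N"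
proof -
  define T where "T = {(a::int, b::int, c::int, d::int). odd a \<and> odd b \<and> odd c \<and> odd d \<and>
      a\<^sup>2 + b\<^sup>2 + c\<^sup>2 + d\<^sup>2 = 4 * int N}"
  define T1 where "T1 = {(a, b, c, d). (a, b, c, d) \<in> T \<and> 4 dvd a + b + c + d}"
  define T2 where "T2 = {(a, b, c, d). (a, b, c, d) \<in> T \<and> \<not> 4 dvd a + b + c + d}"
  define R where "R = {(x::int, y::int, z::int, w::int). x\<^sup>2 + y\<^sup>2 + z\<^sup>2 + w\<^sup>2 = int N}"
  have "finite T" by (rule finite_subset[OF _ finite_four_squares[of "4 * int N"]]) (auto simp: T_def)
  moreover have T12: "T = T1 \<union> T2" "T1 \<inter> T2 = {}" by (auto simp: T1_def T2_def)
  ultimately have "card T = card T1 + card T2"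
    by (metis card_Un_disjoint finite_Un)
  moreover have "card T2 = card T1"
  proof -
    \<comment> \<open>Negating \<open>a\<close> changes an even sum by \<open>2 * a\<close>, which
      is 2 modulo 4.\<close>
    have dvd4: "4 dvd b - a + c + d \<longleftrightarrow> \<not> 4 dvd a + b + c + d"
      if od: "odd a" "odd b" "odd c" "odd d" for a b c d :: int
    proof -
      have "even (b + c + d - a)" using od by simp
      then obtain j where j: "b + c + d - a = 2 * j" by (rule evenE)
      obtain i where i: "a = 2 * i + 1" using od(1) by (rule oddE)
      have "a + b + c + d = 2 * (j + 1) + 4 * i" using i j by simp
      then have "4 dvd a + b + c + d \<longleftrightarrow> 4 dvd 2 * (j + 1)" by (simp add: dvd_add_left_iff)
      moreover have "b - a + c + d = 2 * j" using j by simp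
      ultimately show ?thesis by presburger
    qed
    have "bij_betw (\<lambda>(a, b, c, d). (- a, b, c, d)) T2 T1"
      by (rule bij_betw_byWitness[where f' = "\<lambda>(a, b, c, d). (- a, b, c, d)"])
        (auto simp: T1_def T2_def T_def dvd4)
    then show ?thesis by (rule bij_betw_same_card)
  qed
  moreover have "card R = card T1"
  proof -
    have T1E: "\<exists>x y z w. t = (x + y + z + w, x + y - z - w, x - y + z - w, x - y - z + w)"
      if "t \<in> T1" for t
    proof -
      from that obtain a b c d where t: "t = (a, b, c, d)" and od: "odd a" "odd b" "odd c" "odd d"
        and "4 dvd a + b + c + d" by (auto simp: T1_def T_def)
      then obtain x where x: "a + b + c + d = 4 * x" by (auto elim: dvdE)
      have "even (a + b)" using od by simp
      then obtain i where i: "a + b = 2 * i" by (rule evenE)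
      have "even (a + c)" using od by simp
      then obtain j where j: "a + c = 2 * j" by (rule evenE)
      \<comment> \<open>The witnesses invert the matrix: \<open>x\<close> is a quarter of the sum,
        and the others are (a + b)/2 - x, (a + c)/2 - x and (a + d)/2 - x.\<close>
      show ?thesis unfolding t
        by (rule exI[of _ x], rule exI[of _ "i - x"], rule exI[of _ "j - x"], rule exI[of _ "a - i - j + x"])
          (use x i j in auto)
    qed
    have "bij_betw (\<lambda>(x, y, z, w). (x + y + z + w, x + y - z - w, x - y + z - w, x - y - z + w)) R T1"
      (is "bij_betw ?h R T1")
    proof (rule bij_betw_imageI)
      show "inj_on ?h R" by (auto simp: inj_on_def)
      have norm: "(x + y + z + w)\<^sup>2 + (x + y - z - w)\<^sup>2 + (x - y + z - w)\<^sup>2 + (x - y - z + w)\<^sup>2 =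
          4 * (x\<^sup>2 + y\<^sup>2 + z\<^sup>2 + w\<^sup>2)" for x y z w :: int
        by (simp add: power2_eq_square algebra_simps)
      have par: "odd (x + y + z + w)" if "x\<^sup>2 + y\<^sup>2 + z\<^sup>2 + w\<^sup>2 = int N" for x y z w :: int
      proof -
        have "odd (x\<^sup>2 + y\<^sup>2 + z\<^sup>2 + w\<^sup>2)" unfolding that using assms by simp
        then show ?thesis by simp
      qed
      show "?h ` R = T1"
      proof
        show "?h ` R \<subseteq> T1"
        proof
          fix t assume "t \<in> ?h ` R"
          then obtain x y z w where t: "t = ?h (x, y, z, w)" and R: "x\<^sup>2 + y\<^sup>2 + z\<^sup>2 + w\<^sup>2 = int N"
            by (auto simp: R_def)
          have "x + y + z + w + (x + y - z - w) + (x - y + z - w) + (x - y - z + w) = 4 * x" by simp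
          then have "4 dvd x + y + z + w + (x + y - z - w) + (x - y + z - w) + (x - y - z + w)"
            by (metis dvd_triv_left)
          then show "t \<in> T1" using par[OF R] norm[of x y z w] R by (simp add: t T1_def T_def)
        qed
        show "T1 \<subseteq> ?h ` R"
        proof
          fix t assume "t \<in> T1"
          with T1E obtain x y z w where t: "t = ?h (x, y, z, w)" by fastforce
          with \<open>t \<in> T1\<close> norm[of x y z w] have "(x, y, z, w) \<in> R" by (simp add: T1_def T_def R_def)
          then show "t \<in> ?h ` R" using t by (rule rev_image_eqI)
        qed
      qed
    qed
    then show ?thesis by (rule bij_betw_same_card)
  qed
  moreover have "card T = 16 * sigma N" unfolding T_def using assms by (rule card_four_odd_squares)
  ultimately have "card R = 8 * sigma N" by simp
  then show ?thesis by (simp add: R_def)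
qed

section \<open>The form \<open>x\<^sup>2 + 4 (y\<^sup>2 + z\<^sup>2 + w\<^sup>2)\<close>\<close>

definition all_odd :: "int \<Rightarrow> (int \<times> int \<times> int \<times> int) set" where
  "all_odd k = {(x, y, z, w). x\<^sup>2 + 4 * (y\<^sup>2 + z\<^sup>2 + w\<^sup>2) = k \<and> odd x \<and> odd y \<and> odd z \<and> odd w}"

definition one_odd :: "int \<Rightarrow> (int \<times> int \<times> int \<times> int) set" where
  "one_odd k = {(x, y, z, w). x\<^sup>2 + 4 * (y\<^sup>2 + z\<^sup>2 + w\<^sup>2) = k \<and> odd x \<and> odd y \<and> even z \<and> even w}"

lemma finite_quadruples:
  "finite {(x::int, y::int, z::int, w::int). x\<^sup>2 + 4 * (y\<^sup>2 + z\<^sup>2 + w\<^sup>2) = k \<and> P x y z w}"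
proof (rule finite_subset[OF _ finite_four_squares[of k]])
  have "x\<^sup>2 + y\<^sup>2 + z\<^sup>2 + w\<^sup>2 \<le> k" if "x\<^sup>2 + 4 * (y\<^sup>2 + z\<^sup>2 + w\<^sup>2) = k" for x y z w :: int
  proof -
    define m where "m = y\<^sup>2 + z\<^sup>2 + w\<^sup>2"
    have "m \<ge> 0" by (simp add: m_def)
    then have "x\<^sup>2 + m \<le> k" using that[folded m_def] by linarith
    then show ?thesis by (simp add: m_def add.assoc)
  qed
  then show "{(x, y, z, w). x\<^sup>2 + 4 * (y\<^sup>2 + z\<^sup>2 + w\<^sup>2) = k \<and> P x y z w} \<subseteq>
      {(x, y, z, w). x\<^sup>2 + y\<^sup>2 + z\<^sup>2 + w\<^sup>2 \<le> k}" by auto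
qed

text \<open>An odd square is 1 modulo 8, so 4 m is 4 modulo 8.\<close>

lemma odd_if_mod8:
  assumes "odd (x::int)" "x\<^sup>2 + 4 * m = int N" "N mod 8 = 5"
  shows "odd m"
proof -
  have "int N mod 8 = 5" using assms(3) by presburger
  moreover have "odd m" if "a mod 8 = 1" "(a + 4 * m) mod 8 = 5" for a :: int
    using that by presburger
  ultimately show ?thesis using odd_sq_mod8[OF assms(1)] assms(2) by metis
qed

text \<open>Exactly one of four squares with sum \<open>N\<close> is odd, and by symmetry it is the
  first in a quarter of the cases. Halving the other three roots leaves y^2 + z^2 + w^2 odd, so all
  three new roots or exactly one of them are odd.\<close>

lemma card_all_odd_plus_one_odd:
  assumes "N mod 8 = 5"
  shows "card (all_odd (int N)) + 3 * card (one_odd (int N)) = 2 * sigma N"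
proof -
  have "odd N" using assms by presburger
  have N4: "int N mod 4 = 1" using assms by presburger
  define R where "R = {(x::int, y::int, z::int, w::int). x\<^sup>2 + y\<^sup>2 + z\<^sup>2 + w\<^sup>2 = int N}"
  define R1 where "R1 = {(x, y, z, w). (x, y, z, w) \<in> R \<and> odd x \<and> even y \<and> even z \<and> even w}"
  define R2 where "R2 = {(x, y, z, w). (x, y, z, w) \<in> R \<and> even x \<and> odd y \<and> even z \<and> even w}"
  define R3 where "R3 = {(x, y, z, w). (x, y, z, w) \<in> R \<and> even x \<and> even y \<and> odd z \<and> even w}"
  define R4 where "R4 = {(x, y, z, w). (x, y, z, w) \<in> R \<and> even x \<and> even y \<and> even z \<and> odd w}"
  have "finite R" by (rule finite_subset[OF _ finite_four_squares[of "int N"]]) (auto simp: R_def)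
  moreover have "R1 \<subseteq> R" "R2 \<subseteq> R" "R3 \<subseteq> R" "R4 \<subseteq> R"
    by (auto simp: R1_def R2_def R3_def R4_def)
  ultimately have fin: "finite R1" "finite R2" "finite R3" "finite R4"
    using finite_subset by blast+
  have "R = R1 \<union> (R2 \<union> (R3 \<union> R4))"
  proof -
    have "(x, y, z, w) \<in> R1 \<union> (R2 \<union> (R3 \<union> R4))" if R: "(x, y, z, w) \<in> R" for x y z w
    proof -
      \<comment> \<open>The number of odd coordinates is 1 modulo 4 and at most 4, hence 1.\<close>
      have "(x\<^sup>2 mod 4 + y\<^sup>2 mod 4 + z\<^sup>2 mod 4 + w\<^sup>2 mod 4) mod 4 = 1"
      proof -
        have "[x\<^sup>2 mod 4 + y\<^sup>2 mod 4 + z\<^sup>2 mod 4 + w\<^sup>2 mod 4 = x\<^sup>2 + y\<^sup>2 + z\<^sup>2 + w\<^sup>2] (mod 4)"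
          by (intro cong_add) (simp_all add: cong_def)
        then show ?thesis using R N4 by (simp add: R_def cong_def)
      qed
      then show ?thesis
        unfolding sq_mod4 using R
        by (cases "odd x"; cases "odd y"; cases "odd z"; cases "odd w")
          (simp_all add: R1_def R2_def R3_def R4_def)
    qed
    then show ?thesis using \<open>R1 \<subseteq> R\<close> \<open>R2 \<subseteq> R\<close> \<open>R3 \<subseteq> R\<close> \<open>R4 \<subseteq> R\<close> by fast
  qed
  moreover have "R1 \<inter> (R2 \<union> (R3 \<union> R4)) = {}" "R2 \<inter> (R3 \<union> R4) = {}" "R3 \<inter> R4 = {}"
    by (auto simp: R1_def R2_def R3_def R4_def)
  ultimately have "card R = card R1 + (card R2 + (card R3 + card R4))"
    using fin by (simp add: card_Un_disjoint)
  moreover have "card R2 = card R1"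
    by (rule bij_betw_same_card[of "\<lambda>(x, y, z, w). (y, x, z, w)"],
        rule bij_betw_byWitness[where f' = "\<lambda>(x, y, z, w). (y, x, z, w)"])
      (auto simp: R1_def R2_def R_def)
  moreover have "card R3 = card R1"
    by (rule bij_betw_same_card[of "\<lambda>(x, y, z, w). (z, y, x, w)"],
        rule bij_betw_byWitness[where f' = "\<lambda>(x, y, z, w). (z, y, x, w)"])
      (auto simp: R1_def R3_def R_def)
  moreover have "card R4 = card R1"
    by (rule bij_betw_same_card[of "\<lambda>(x, y, z, w). (w, y, z, x)"],
        rule bij_betw_byWitness[where f' = "\<lambda>(x, y, z, w). (w, y, z, x)"])
      (auto simp: R1_def R4_def R_def)
  moreover have "card R = 8 * sigma N"
    unfolding R_def using \<open>odd N\<close> by (rule card_four_squares)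
  ultimately have R1: "card R1 = 2 * sigma N" by simp

  define A where "A = all_odd (int N)"
  define B1 where "B1 = one_odd (int N)"
  define B2 where "B2 = {(x, y, z, w). (x, z, y, w) \<in> B1}"
  define B3 where "B3 = {(x, y, z, w). (x, w, z, y) \<in> B1}"
  define X where "X = {(x::int, y::int, z::int, w::int). x\<^sup>2 + 4 * (y\<^sup>2 + z\<^sup>2 + w\<^sup>2) = int N}"
  have "bij_betw (\<lambda>(x, y, z, w). (x, 2 * y, 2 * z, 2 * w)) X R1"
  proof (rule bij_betw_byWitness[where f' = "\<lambda>(x, y, z, w). (x, y div 2, z div 2, w div 2)"])
    have "odd x" if "x\<^sup>2 + 4 * (y\<^sup>2 + z\<^sup>2 + w\<^sup>2) = int N" for x y z w :: int
    proof -
      have "odd (x\<^sup>2 + 4 * (y\<^sup>2 + z\<^sup>2 + w\<^sup>2))" unfolding that using \<open>odd N\<close> by simp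
      then show ?thesis by simp
    qed
    then show "(\<lambda>(x, y, z, w). (x, 2 * y, 2 * z, 2 * w)) ` X \<subseteq> R1"
      by (auto simp: R1_def R_def X_def power_mult_distrib)
  qed (auto simp: X_def R1_def R_def power_mult_distrib elim!: evenE)
  then have "card X = 2 * sigma N" using R1 bij_betw_same_card by metis
  moreover have "X = A \<union> (B1 \<union> (B2 \<union> B3))"
  proof -
    have "(x, y, z, w) \<in> A \<union> (B1 \<union> (B2 \<union> B3))" if X: "(x, y, z, w) \<in> X" for x y z w
    proof -
      have eq: "x\<^sup>2 + 4 * (y\<^sup>2 + z\<^sup>2 + w\<^sup>2) = int N" using X by (simp add: X_def)
      have "odd (x\<^sup>2 + 4 * (y\<^sup>2 + z\<^sup>2 + w\<^sup>2))" unfolding eq using \<open>odd N\<close> by simp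
      then have "odd x" by simp
      from this eq assms have "odd (y\<^sup>2 + z\<^sup>2 + w\<^sup>2)" by (rule odd_if_mod8)
      then show ?thesis
        using eq \<open>odd x\<close>
        by (cases "odd y"; cases "odd z"; cases "odd w")
          (simp_all add: A_def B1_def B2_def B3_def all_odd_def one_odd_def algebra_simps)
    qed
    moreover have "A \<subseteq> X" "B1 \<subseteq> X" "B2 \<subseteq> X" "B3 \<subseteq> X"
      by (auto simp: A_def B1_def B2_def B3_def X_def all_odd_def one_odd_def algebra_simps)
    ultimately show ?thesis by fast
  qed
  moreover have "finite X" using finite_quadruples[of "int N" "\<lambda>_ _ _ _. True"] by (simp add: X_def)
  moreover have "A \<inter> (B1 \<union> (B2 \<union> B3)) = {}" "B1 \<inter> (B2 \<union> B3) = {}" "B2 \<inter> B3 = {}"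
    by (auto simp: A_def B1_def B2_def B3_def all_odd_def one_odd_def)
  ultimately have "card A + (card B1 + (card B2 + card B3)) = 2 * sigma N"
    by (simp add: card_Un_disjoint)
  moreover have "card B2 = card B1"
    by (rule bij_betw_same_card[of "\<lambda>(x, y, z, w). (x, z, y, w)"],
        rule bij_betw_byWitness[where f' = "\<lambda>(x, y, z, w). (x, z, y, w)"])
      (auto simp: B2_def)
  moreover have "card B3 = card B1"
    by (rule bij_betw_same_card[of "\<lambda>(x, y, z, w). (x, w, z, y)"],
        rule bij_betw_byWitness[where f' = "\<lambda>(x, y, z, w). (x, w, z, y)"])
      (auto simp: B3_def)
  ultimately show ?thesis by (simp add: A_def B1_def)
qed

text \<open>Since \<open>chi r * r\<close> is invariant under \<open>r\<close> to
  \<open>- r\<close>, both odd classes modulo 4 contribute equally, whence the factor 2. The parity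
  conditions, absent from \<open>S\<close>, are forced by \<open>N\<close> modulo 8.\<close>

lemma sum_chi_eq_S:
  assumes "N mod 8 = 5"
  shows "(\<Sum>(r, s) | odd r \<and> odd s \<and> r\<^sup>2 + 4 * s\<^sup>2 = int N. chi r * real_of_int r) = 2 * real_of_int (S 4 N)"
proof -
  define T where "T = {(r::int, s::int). odd r \<and> odd s \<and> r\<^sup>2 + 4 * s\<^sup>2 = int N}"
  define T1 where "T1 = {(r, s). (r, s) \<in> T \<and> [r = 1] (mod 4)}"
  define T2 where "T2 = {(r, s). (r, s) \<in> T \<and> \<not> [r = 1] (mod 4)}"
  define f :: "int \<times> int \<Rightarrow> real" where "f = (\<lambda>(r, s). chi r * real_of_int r)"
  have "finite T"
  proof (rule finite_subset)
    show "T \<subseteq> {r. 1 * r\<^sup>2 \<le> int N} \<times> {s. 4 * s\<^sup>2 \<le> int N}"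
    proof
      fix z assume "z \<in> T"
      then obtain r s where z: "z = (r, s)" "r\<^sup>2 + 4 * s\<^sup>2 = int N" by (auto simp: T_def)
      have "0 \<le> r\<^sup>2" "0 \<le> s\<^sup>2" by simp_all
      with z(2) have "1 * r\<^sup>2 \<le> int N" "4 * s\<^sup>2 \<le> int N" by linarith+
      then show "z \<in> {r. 1 * r\<^sup>2 \<le> int N} \<times> {s. 4 * s\<^sup>2 \<le> int N}" using z(1) by simp
    qed
  qed (intro finite_cartesian_product finite_int_square_bounded; simp)
  moreover have "T = T1 \<union> T2" "T1 \<inter> T2 = {}" by (auto simp: T1_def T2_def)
  ultimately have "sum f T = sum f T1 + sum f T2"
    by (metis finite_Un sum.union_disjoint)
  moreover have "sum f T2 = sum f T1"
  proof (rule sum.reindex_bij_witness[of _ "\<lambda>(r, s). (- r, s)" "\<lambda>(r, s). (- r, s)"])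
    have cong_minus: "[- r = 1] (mod 4) \<longleftrightarrow> \<not> [r = 1] (mod 4)" if "odd r" for r :: int
      using chi_minus[OF that] by (auto simp: chi_def split: if_splits)
    show "(case z of (r, s) \<Rightarrow> (- r, s)) \<in> T1" if "z \<in> T2" for z
      using that by (auto simp: T1_def T2_def T_def cong_minus)
    show "(case z of (r, s) \<Rightarrow> (- r, s)) \<in> T2" if "z \<in> T1" for z
      using that by (auto simp: T1_def T2_def T_def cong_minus)
  qed (auto simp: f_def T2_def T_def chi_minus)
  moreover have "sum f T1 = real_of_int (S 4 N)"
  proof -
    have "T1 = {(r, s). int N = r\<^sup>2 + int 4 * s\<^sup>2 \<and> [r = 1] (mod 4)}"
    proof -
      have "odd r \<and> odd s" if "r\<^sup>2 + 4 * s\<^sup>2 = int N" for r s :: int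
      proof -
        have "odd N" using assms by presburger
        then have "odd (r\<^sup>2 + 4 * s\<^sup>2)" unfolding that by simp
        then have "odd r" by simp
        from this that assms have "odd (s\<^sup>2)" by (rule odd_if_mod8)
        with \<open>odd r\<close> show ?thesis by simp
      qed
      then show ?thesis by (auto simp: T1_def T_def)
    qed
    then have "S 4 N = (\<Sum>(r, s)\<in>T1. r)" by (simp add: S_def)
    also have "real_of_int \<dots> = sum f T1"
      by (auto simp: f_def chi_def T1_def intro!: sum.cong)
    finally show ?thesis ..
  qed
  ultimately show ?thesis by (simp add: T_def f_def)
qed

text \<open>The coefficient of \<open>theta_chi * Y\<close> at \<open>N\<close> is read off twice:
  directly, and after replacing \<open>theta_chi\<close> by its product formula.\<close>

lemma card_one_odd_minus_all_odd:
  assumes "N mod 8 = 5"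
  shows "real (card (one_odd (int N))) - real (card (all_odd (int N))) = 2 * real_of_int (S 4 N)"
proof -
  let ?O = "{x::int. odd x}"
  define Y where "Y = weighted_gf ?O (\<lambda>y::int. nat (4 * y\<^sup>2)) (\<lambda>_. 1)"
  let ?f1 = "\<lambda>(r::int, s::int). nat (r\<^sup>2) + nat (4 * s\<^sup>2)"
  have "theta_chi * Y = weighted_gf (?O \<times> ?O) ?f1 (\<lambda>(r, s). chi r * r)"
    unfolding theta_chi_def Y_def
    apply (subst weighted_gf_mult, (intro finite_fibres_intros; simp; fail)+)+
    apply (rule weighted_gf_cong; clarsimp)
    done
  then have "(theta_chi * Y) $ N = (\<Sum>z | z \<in> ?O \<times> ?O \<and> ?f1 z = N. case z of (r, s) \<Rightarrow> chi r * r)"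
    by (simp add: weighted_gf_nth)
  also have "{z. z \<in> ?O \<times> ?O \<and> ?f1 z = N} = {(r, s). odd r \<and> odd s \<and> r\<^sup>2 + 4 * s\<^sup>2 = int N}"
    by (auto simp: nat_add_distrib[symmetric] nat_eq_iff)
  finally have lhs: "(theta_chi * Y) $ N = 2 * real_of_int (S 4 N)"
    using sum_chi_eq_S[OF assms] by simp

  let ?A = "?O \<times> ?O \<times> (UNIV::int set) \<times> (UNIV::int set)"
  let ?f2 = "\<lambda>(x::int, y::int, u::int, v::int). nat (x\<^sup>2) + (nat (4 * y\<^sup>2) + (nat (8 * u\<^sup>2) + nat (8 * v\<^sup>2)))"
  have "theta_chi * Y = theta_odd * (Y * (theta_alt * theta_alt))"
    by (simp add: theta_chi_eq power2_eq_square mult_ac)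
  also have "\<dots> = weighted_gf ?A ?f2 (\<lambda>(x, y, u, v). parity_sign u * parity_sign v)"
    unfolding theta_odd_def Y_def theta_alt_def
    apply (subst weighted_gf_mult, (intro finite_fibres_intros; simp; fail)+)+
    apply (rule weighted_gf_cong; clarsimp)
    done
  finally have "(theta_chi * Y) $ N = (\<Sum>z | z \<in> ?A \<and> ?f2 z = N. case z of (x, y, u, v) \<Rightarrow> parity_sign u * parity_sign v)"
    by (simp add: weighted_gf_nth)
  also have "{z. z \<in> ?A \<and> ?f2 z = N} =
      {(x, y, u, v). odd x \<and> odd y \<and> x\<^sup>2 + 4 * y\<^sup>2 + 8 * u\<^sup>2 + 8 * v\<^sup>2 = int N}"
    by (auto simp: nat_add_distrib[symmetric] nat_eq_iff add.assoc)
  \<comment> \<open>The pairs (u + v, u - v) are those of equal parity: both even in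
    \<open>one_odd\<close>, both odd in \<open>all_odd\<close>. The sign depends only on the parity
    of \<open>z = u + v\<close>.\<close>
  also have "(\<Sum>(x, y, u, v)\<in>\<dots>. parity_sign u * parity_sign v) = (\<Sum>(x, y, z, w)\<in>one_odd (int N) \<union> all_odd (int N). parity_sign z)"
  proof (rule sum.reindex_bij_witness[of _ "\<lambda>(x, y, z, w). (x, y, (z + w) div 2, (z - w) div 2)"
          "\<lambda>(x, y, u, v). (x, y, u + v, u - v)"])
    have norm: "4 * (y\<^sup>2 + (u + v)\<^sup>2 + (u - v)\<^sup>2) = 4 * y\<^sup>2 + 8 * u\<^sup>2 + 8 * v\<^sup>2" for y u v :: int
      by (simp add: power2_eq_square algebra_simps)
    fix t
    assume "t \<in> one_odd (int N) \<union> all_odd (int N)"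
    then obtain x y z w where t: "t = (x, y, z, w)" and "even (z + w)"
      and xy: "odd x" "odd y" "x\<^sup>2 + 4 * (y\<^sup>2 + z\<^sup>2 + w\<^sup>2) = int N"
      by (auto simp: one_odd_def all_odd_def)
    from \<open>even (z + w)\<close> obtain u where "z + w = 2 * u" by (rule evenE)
    define v where "v = u - w"
    have zw: "z = u + v" "w = u - v" using \<open>z + w = 2 * u\<close> by (auto simp: v_def)
    show "(case case t of (x, y, z, w) \<Rightarrow> (x, y, (z + w) div 2, (z - w) div 2) of
        (x, y, u, v) \<Rightarrow> (x, y, u + v, u - v)) = t"
      by (simp add: t zw)
    show "(case t of (x, y, z, w) \<Rightarrow> (x, y, (z + w) div 2, (z - w) div 2)) \<in>
        {(x, y, u, v). odd x \<and> odd y \<and> x\<^sup>2 + 4 * y\<^sup>2 + 8 * u\<^sup>2 + 8 * v\<^sup>2 = int N}"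
      using xy unfolding zw norm by (simp add: t zw)
  next
    fix t
    assume "t \<in> {(x, y, u, v). odd x \<and> odd y \<and> x\<^sup>2 + 4 * y\<^sup>2 + 8 * u\<^sup>2 + 8 * v\<^sup>2 = int N}"
    then obtain x y u v where t: "t = (x, y, u, v)"
      and xy: "odd x" "odd y" "x\<^sup>2 + 4 * y\<^sup>2 + 8 * u\<^sup>2 + 8 * v\<^sup>2 = int N" by auto
    have "x\<^sup>2 + 4 * (y\<^sup>2 + (u + v)\<^sup>2 + (u - v)\<^sup>2) = int N"
      using xy(3) by (simp add: power2_eq_square algebra_simps)
    then show "(case t of (x, y, u, v) \<Rightarrow> (x, y, u + v, u - v)) \<in> one_odd (int N) \<union> all_odd (int N)"
      using xy(1,2) by (auto simp: t one_odd_def all_odd_def)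
  qed (auto simp: parity_sign_add)
  also have "\<dots> = (\<Sum>(x, y, z, w)\<in>one_odd (int N). parity_sign z) + (\<Sum>(x, y, z, w)\<in>all_odd (int N). parity_sign z)"
  proof (rule sum.union_disjoint)
    show "finite (one_odd (int N))" "finite (all_odd (int N))"
      unfolding one_odd_def all_odd_def by (rule finite_quadruples)+
  qed (auto simp: one_odd_def all_odd_def)
  also have "(\<Sum>(x, y, z, w)\<in>one_odd (int N). parity_sign z) = (\<Sum>_\<in>one_odd (int N). 1)"
    by (rule sum.cong) (auto simp: one_odd_def parity_sign_def)
  also have "(\<Sum>(x, y, z, w)\<in>all_odd (int N). parity_sign z) = (\<Sum>_\<in>all_odd (int N). - 1)"
    by (rule sum.cong) (auto simp: all_odd_def parity_sign_def)
  finally show ?thesis unfolding lhs by simp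
qed

section \<open>Triangular numbers and the final count\<close>

text \<open>Complete the squares: (2x - 1)^2 is 8 times a triangular number plus 1,
  \<open>2 * x - 1\<close> runs once through the odd integers, and 13 = 1 + 3 * 4.\<close>

lemma t_eq_card_all_odd: "t 1 4 4 4 n = card (all_odd (int (8 * n + 13)))"
proof -
  define tri :: "int \<Rightarrow> int" where "tri = (\<lambda>x. x * (x - 1) div 2)"
  have tri: "(2 * x - 1)\<^sup>2 = 8 * tri x + 1" for x
  proof -
    have "even (x * (x - 1))" by simp
    then obtain j where j: "x * (x - 1) = 2 * j" by (rule evenE)
    then show ?thesis by (simp add: tri_def j power2_eq_square algebra_simps)
  qed
  have mem: "(2 * x - 1, 2 * y - 1, 2 * z - 1, 2 * w - 1) \<in> all_odd (int (8 * n + 13)) \<longleftrightarrow>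
      int n = int 1 * tri x + int 4 * tri y + int 4 * tri z + int 4 * tri w" for x y z w
    unfolding all_odd_def by (auto simp: tri)
  have "bij_betw (\<lambda>(x, y, z, w). (2 * x - 1, 2 * y - 1, 2 * z - 1, 2 * w - 1))
    {(x, y, z, w). int n = int 1 * tri x + int 4 * tri y + int 4 * tri z + int 4 * tri w}
    (all_odd (int (8 * n + 13)))" (is "bij_betw ?h ?T ?A")
  proof (rule bij_betw_imageI)
    show "inj_on ?h ?T" by (auto simp: inj_on_def)
    show "?h ` ?T = ?A"
    proof
      show "?h ` ?T \<subseteq> ?A" using mem by auto
      show "?A \<subseteq> ?h ` ?T"
      proof
        fix q assume q: "q \<in> ?A"
        have half: "2 * ((a + 1) div 2) - 1 = a" if "odd a" for a :: int using that by presburger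
        from q obtain x y z w where xyzw: "q = (x, y, z, w)" "odd x" "odd y" "odd z" "odd w"
          by (auto simp: all_odd_def)
        let ?p = "((x + 1) div 2, (y + 1) div 2, (z + 1) div 2, (w + 1) div 2)"
        have p: "q = ?h ?p" by (simp only: xyzw(1) prod.case half[OF xyzw(2)] half[OF xyzw(3)] half[OF xyzw(4)] half[OF xyzw(5)])
        then have "?p \<in> ?T" using q mem by simp
        then show "q \<in> ?h ` ?T" using p by (rule rev_image_eqI)
      qed
    qed
  qed
  then show ?thesis unfolding t_def tri_def by (rule bij_betw_same_card)
qed

theorem theorem3p2:
  fixes n :: nat
  assumes "n \<ge> 1"
  shows "real (t 1 4 4 4 n) =
    1 / 2 * (real (sigma (8 * n + 13)) - 3 * real_of_int (S 4 (8 * n + 13)))"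
proof -
  have N: "(8 * n + 13) mod 8 = 5" by presburger
  have "real (card (all_odd (int (8 * n + 13)))) + 3 * real (card (one_odd (int (8 * n + 13)))) =
      2 * real (sigma (8 * n + 13))"
    using arg_cong[OF card_all_odd_plus_one_odd[OF N], of real] by simp
  \<comment> \<open>From A + 3 B = 2 sigma and B - A = 2 S, eliminating B gives 4 A = 2 sigma - 6
    S.\<close>
  then show ?thesis
    using card_one_odd_minus_all_odd[OF N] unfolding t_eq_card_all_odd by argo
qed

end
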